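(* Let $q$ be a prime power, $n$ a positive integer, $\sigma:\mathbb{F}_{q^n}\to\mathbb{F}_{q^n}$ the Frobenius map $\sigma(x)=x^q$, and $\operatorname{Tr}:\mathbb{F}_{q^n}\to\mathbb{F}_q$ the trace. For nonzero $\alpha\in\mathbb{F}_{q^n}$ let $V_\alpha=\{x\in\mathbb{F}_{q^n}:\operatorname{Tr}(\alpha x)=0\}$. (i) If $\alpha,\sigma(\alpha),\dots,\sigma^{n-1}(\alpha)$ are linearly independent over $\mathbb{F}_q$, then $V_\alpha$ is not a cyclically covering subspace of $\mathbb{F}_{q^n}$. (ii) Let $\alpha,\sigma(\alpha),\dots,\sigma^{t-1}(\alpha)$ be a maximal $\mathbb{F}_q$-linearly independent subset of $\{\alpha,\sigma(\alpha),\dots,\sigma^{n-1}(\alpha)\}$, and for each $i$ write $\sigma^i(\alpha)=k_{i1}\alpha+k_{i2}\sigma(\alpha)+\dots+k_{it}\sigma^{t-1}(\alpha)$ with $k_{ij}\in\mathbb{F}_q$. Then $V_\alpha$ is a cyclically covering subspace of $\mathbb{F}_{q^n}$ if and only if for every $(x_1,\dots,x_t)\in(\mathbb{F}_q^* )^t$ there exists an integer $i$ with $t\le i\le n-1$ such that \[k_{i1}x_1+k_{i2}x_2+\dots+k_{it}x_t=0.\]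
   Context: A subspace $U$ of the $\mathbb{F}_q$-vector space $\mathbb{F}_{q^n}$ is cyclically covering if $\bigcup_{i=0}^{n-1}\sigma^i(U)=\mathbb{F}_{q^n}$, where $\sigma$ is the Frobenius map $x\mapsto x^q$. *)

theory Defs
  imports "HOL-Algebra.Algebra" "HOL-Number_Theory.Prime_Powers"
begin

text \<open>
  The field \<open>F_{q^n}\<close> is a HOL-Algebra field \<open>L\<close> with \<open>q^n\<close> elements and its subfield \<open>F_q\<close> is a
  subset \<open>K\<close> of the carrier with \<open>q\<close> elements.
\<close>

definition frobenius :: "('a, 'b) ring_scheme \<Rightarrow> nat \<Rightarrow> 'a \<Rightarrow> 'a" where
  "frobenius L q x = x [^]\<^bsub>L\<^esub> q"

text \<open>The trace from \<open>F_{q^n}\<close> to \<open>F_q\<close>: the sum of the conjugates \<open>x, x^q, \<dots>, x^(q^(n-1))\<close>.\<close>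

definition field_trace :: "('a, 'b) ring_scheme \<Rightarrow> nat \<Rightarrow> nat \<Rightarrow> 'a \<Rightarrow> 'a" where
  "field_trace L q n x = (\<Oplus>\<^bsub>L\<^esub>i\<in>{..<n}. (frobenius L q ^^ i) x)"

definition trace_hyperplane :: "('a, 'b) ring_scheme \<Rightarrow> nat \<Rightarrow> nat \<Rightarrow> 'a \<Rightarrow> 'a set" where
  "trace_hyperplane L q n \<alpha> = {x \<in> carrier L. field_trace L q n (\<alpha> \<otimes>\<^bsub>L\<^esub> x) = \<zero>\<^bsub>L\<^esub>}"

text \<open>\<open>subalgebra K U L\<close> says that \<open>U\<close> is a \<open>K\<close>-linear subspace of \<open>L\<close>; it does not require
  closure under the multiplication of \<open>L\<close>.\<close>

definition cyclically_covering ::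
    "('a, 'b) ring_scheme \<Rightarrow> 'a set \<Rightarrow> nat \<Rightarrow> nat \<Rightarrow> 'a set \<Rightarrow> bool" where
  "cyclically_covering L K q n U \<longleftrightarrow>
     subalgebra K U L \<and> (\<Union>i\<in>{..<n}. (frobenius L q ^^ i) ` U) = carrier L"

definition conjugates :: "('a, 'b) ring_scheme \<Rightarrow> nat \<Rightarrow> nat \<Rightarrow> 'a \<Rightarrow> 'a list" where
  "conjugates L q m \<alpha> = map (\<lambda>i. (frobenius L q ^^ i) \<alpha>) [0..<m]"

text \<open>Independence is a property of lists in the library, so that repeated entries count as
  dependent; subsets of \<open>A\<close> are accordingly represented by lists with entries in \<open>A\<close>.\<close>

definition maximal_independent_in ::
    "('a, 'b) ring_scheme \<Rightarrow> 'a set \<Rightarrow> 'a list \<Rightarrow> 'a set \<Rightarrow> bool" where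
  "maximal_independent_in L K vs A \<longleftrightarrow>
     ring.independent L K vs \<and> set vs \<subseteq> A \<and>
     (\<forall>ws. ring.independent L K ws \<longrightarrow> set vs \<subseteq> set ws \<longrightarrow> set ws \<subseteq> A \<longrightarrow> set ws = set vs)"

lemma (in cring) binomial_finsum:
  assumes x: "x \<in> carrier R" and y: "y \<in> carrier R"
  shows "(x \<oplus> y) [^] (n::nat) =
         (\<Oplus>k\<in>{..n}. [(n choose k)] \<cdot> (x [^] k \<otimes> y [^] (n - k)))"
proof (induction n)
  case 0
  then show ?case by (simp add: add.nat_pow_eone)
next
  case (Suc n)
  define f where "f k = [(n choose k)] \<cdot> (x [^] k \<otimes> y [^] (n - k))" for k
  define g where "g k = [(n choose k)] \<cdot> (x [^] Suc k \<otimes> y [^] (n - k))" for k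
  define h where "h k = [(n choose k)] \<cdot> (x [^] k \<otimes> y [^] (Suc n - k))" for k
  define F where "F k = [(Suc n choose k)] \<cdot> (x [^] k \<otimes> y [^] (Suc n - k))" for k
  have cl: "f k \<in> carrier R" "g k \<in> carrier R" "h k \<in> carrier R" "F k \<in> carrier R" for k
    using x y by (auto simp: f_def g_def h_def F_def simp del: nat_pow_Suc)
  have fx: "f k \<otimes> x = g k" for k
    unfolding f_def g_def using x y
    by (simp add: add_pow_ldistr m_assoc m_comm[of "y [^] (n - k)" x])
  have fy: "f k \<otimes> y = h k" if "k \<le> n" for k
    unfolding f_def h_def using x y that
    by (simp add: add_pow_ldistr m_assoc Suc_diff_le)
  have F: "F (Suc k) = g k \<oplus> h (Suc k)" for k
    unfolding F_def g_def h_def using x y by (simp add: add.nat_pow_mult del: nat_pow_Suc)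
  have h_last: "h (Suc n) = \<zero>"
    unfolding h_def using binomial_eq_0[of n "Suc n"] by (simp only: add.nat_pow_0 lessI)
  have "(x \<oplus> y) [^] Suc n = (\<Oplus>k\<in>{..n}. f k) \<otimes> (x \<oplus> y)"
    using Suc by (simp add: f_def)
  also have "\<dots> = (\<Oplus>k\<in>{..n}. f k \<otimes> x) \<oplus> (\<Oplus>k\<in>{..n}. f k \<otimes> y)"
    using x y cl by (simp add: r_distr finsum_ldistr Pi_def)
  also have "(\<Oplus>k\<in>{..n}. f k \<otimes> x) = (\<Oplus>k\<in>{..n}. g k)"
    by (simp add: fx)
  also have "(\<Oplus>k\<in>{..n}. f k \<otimes> y) = (\<Oplus>k\<in>{..n}. h k)"
    by (rule finsum_cong') (auto simp: fy cl)
  also have "(\<Oplus>k\<in>{..n}. h k) = (\<Oplus>k\<in>{..Suc n}. h k)"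
    using cl h_last by (simp add: Pi_def finsum_Suc)
  also have "\<dots> = (\<Oplus>k\<in>{..n}. h (Suc k)) \<oplus> h 0"
    using cl by (intro finsum_Suc2) auto
  also have "h 0 = F 0" by (simp add: h_def F_def)
  also have "(\<Oplus>k\<in>{..n}. g k) \<oplus> ((\<Oplus>k\<in>{..n}. h (Suc k)) \<oplus> F 0)
           = (\<Oplus>k\<in>{..n}. F (Suc k)) \<oplus> F 0"
    using cl by (simp add: F finsum_addf Pi_def a_assoc)
  also have "\<dots> = (\<Oplus>k\<in>{..Suc n}. F k)"
    using cl by (intro finsum_Suc2[symmetric]) auto
  finally show ?case by (simp add: F_def)
qed

lemma (in cring) prime_char_pow_add:
  assumes p: "Factorial_Ring.prime (p::nat)" "[p] \<cdot> \<one> = \<zero>"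
    and x: "x \<in> carrier R" and y: "y \<in> carrier R"
  shows "(x \<oplus> y) [^] p = x [^] p \<oplus> y [^] p"
proof -
  define F where "F k = [(p choose k)] \<cdot> (x [^] k \<otimes> y [^] (p - k))" for k
  have cl: "F k \<in> carrier R" for k using x y by (simp add: F_def)
  have pz: "[p] \<cdot> z = \<zero>" if "z \<in> carrier R" for z
    using add_pow_ldistr[of \<one> z p] p that by simp
  have F0: "F k = \<zero>" if "k \<in> {0<..<p}" for k
  proof -
    have "p dvd (p choose k)"
      by (rule dvd_choose_prime) (use p that in auto)
    then obtain m where m: "p choose k = p * m"
      by (rule dvdE)
    show ?thesis
      unfolding F_def m using x y pz by (simp add: add.nat_pow_pow[symmetric])
  qed
  have "(x \<oplus> y) [^] p = (\<Oplus>k\<in>{..p}. F k)"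
    by (simp add: binomial_finsum x y F_def)
  also have "\<dots> = (\<Oplus>k\<in>{0, p}. F k)"
    by (rule add.finprod_mono_neutral_cong_right) (auto simp: cl intro!: F0)
  also have "\<dots> = F 0 \<oplus> F p"
    using cl prime_gt_0_nat[OF p(1)] by simp
  also have "\<dots> = x [^] p \<oplus> y [^] p"
    using x y by (simp add: F_def a_comm)
  finally show ?thesis .
qed

context
  fixes L :: "('a, 'b) ring_scheme" (structure) and K :: "'a set" and q n :: nat
  assumes L: "field L" and K: "subfield K L" and q: "primepow q"
    and card_K: "card K = q" and card_L: "card (carrier L) = q ^ n"
begin

interpretation field L by (rule L)

lemma frobenius_add:
  assumes x: "x \<in> carrier L" and y: "y \<in> carrier L"
  shows "frobenius L q (x \<oplus> y) = frobenius L q x \<oplus> frobenius L q y"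
proof -
  obtain p e where pe: "Factorial_Ring.prime p" "q = p ^ e"
    using q by (auto simp: primepow_def)
  define one' where "one' m = [(m::nat)] \<cdot> \<one>" for m
  have one': "one' m \<in> carrier L" for m by (simp add: one'_def)
  have mult: "one' (a * b) = one' a \<otimes> one' b" for a b
    by (simp add: one'_def add_pow_ldistr add.nat_pow_pow mult.commute)
  have "one' (order (add_monoid L)) = \<zero>"
    using add.pow_order_eq_1[of \<one>] by (simp add: one'_def add_pow_def)
  moreover have "order (add_monoid L) = p ^ (e * n)"
    using card_L pe by (simp add: order_def power_mult)
  ultimately have z: "one' (p ^ (e * n)) = \<zero>" by simp
  have "one' p = \<zero>" if "one' (p ^ m) = \<zero>" for m
    using that
  proof (induction m)
    case 0 then show ?case by (simp add: one'_def)
  next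
    case (Suc m) then show ?case using mult[of p "p ^ m"] one' integral by auto
  qed
  with z have pz: "[p] \<cdot> \<one> = \<zero>" by (simp add: one'_def)
  have "(x \<oplus> y) [^] (p ^ m) = x [^] (p ^ m) \<oplus> y [^] (p ^ m)" for m
  proof (induction m)
    case 0 show ?case using x y by simp
  next
    case (Suc m)
    then show ?case
      using x y prime_char_pow_add[OF pe(1) pz, of "x [^] (p ^ m)" "y [^] (p ^ m)"]
        nat_pow_pow[of "x \<oplus> y" "p ^ m" p]
      by (simp add: nat_pow_pow mult.commute[of p])
  qed
  then show ?thesis by (simp add: frobenius_def pe)
qed

lemma frobenius_fixes_subfield:
  assumes c: "c \<in> K"
  shows "frobenius L q c = c"
proof (cases "c = \<zero>")
  case True
  have "q > 0" using q primepow_gt_Suc_0 by fastforce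
  with True show ?thesis by (simp add: frobenius_def nat_pow_zero)
next
  case False
  have K': "field (L\<lparr>carrier := K\<rparr>)" using subfield_iff(2)[OF K] .
  have q1: "q > 1" using q primepow_gt_Suc_0 by fastforce
  then have fin: "finite K" using card_K card.infinite by fastforce
  let ?M = "Multiplicative_Group.mult_of (L\<lparr>carrier := K\<rparr>)"
  have "order ?M = q - 1"
    using field.order_mult_of[OF K'] fin card_K by (simp add: order_def)
  moreover have "c [^]\<^bsub>?M\<^esub> order ?M = \<one>\<^bsub>?M\<^esub>"
    using group.pow_order_eq_1[OF field.field_mult_group[OF K'], of c] c False by simp
  ultimately have "c [^] (q - 1) = \<one>"
    by (simp add: nat_pow_def)
  moreover have "c \<in> carrier L" using subfieldE(3)[OF K] c by auto
  moreover have "c [^] q = c [^] (q - 1) \<otimes> c"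
    using q1 nat_pow_Suc[of c "q - 1"] by simp
  ultimately show ?thesis by (simp add: frobenius_def)
qed

lemma frobenius_iter_linear:
  assumes x: "x \<in> carrier L" and y: "y \<in> carrier L" and c: "c \<in> K"
  shows "(frobenius L q ^^ i) x \<in> carrier L"
    and "(frobenius L q ^^ i) (x \<oplus> y) = (frobenius L q ^^ i) x \<oplus> (frobenius L q ^^ i) y"
    and "(frobenius L q ^^ i) (c \<otimes> x) = c \<otimes> (frobenius L q ^^ i) x"
proof -
  have cL: "c \<in> carrier L" using subfieldE(3)[OF K] c by auto
  have cl: "(frobenius L q ^^ i) z \<in> carrier L" if "z \<in> carrier L" for i z
    using that by (induction i) (auto simp: frobenius_def)
  show "(frobenius L q ^^ i) x \<in> carrier L" using cl x .
  show "(frobenius L q ^^ i) (x \<oplus> y) = (frobenius L q ^^ i) x \<oplus> (frobenius L q ^^ i) y"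
    by (induction i) (auto simp: frobenius_add cl x y)
  show "(frobenius L q ^^ i) (c \<otimes> x) = c \<otimes> (frobenius L q ^^ i) x"
  proof (induction i)
    case (Suc i)
    have "frobenius L q (c \<otimes> (frobenius L q ^^ i) x)
        = frobenius L q c \<otimes> frobenius L q ((frobenius L q ^^ i) x)"
      using cL cl[OF x] by (simp add: frobenius_def nat_pow_distrib)
    with Suc show ?case by (simp add: frobenius_fixes_subfield c)
  qed simp
qed

lemma trace_linear:
  assumes x: "x \<in> carrier L" and y: "y \<in> carrier L" and c: "c \<in> K"
  shows "field_trace L q n (x \<oplus> y) = field_trace L q n x \<oplus> field_trace L q n y"
    and "field_trace L q n (c \<otimes> x) = c \<otimes> field_trace L q n x"
proof -
  have cL: "c \<in> carrier L" using subfieldE(3)[OF K] c by auto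
  note lin = frobenius_iter_linear
  show "field_trace L q n (x \<oplus> y) = field_trace L q n x \<oplus> field_trace L q n y"
    using lin(1)[OF x x c] lin(1)[OF y y c] lin(2)[OF x y c]
    by (simp add: field_trace_def finsum_addf Pi_def)
  show "field_trace L q n (c \<otimes> x) = c \<otimes> field_trace L q n x"
    using lin(1)[OF x x c] lin(3)[OF x x c] cL
    by (simp add: field_trace_def finsum_rdistr Pi_def)
qed

text \<open>Hence the subspace condition in \<open>cyclically_covering\<close> always holds for
  \<open>trace_hyperplane\<close>.\<close>

lemma trace_hyperplane_subspace:
  assumes a: "\<alpha> \<in> carrier L"
  shows "subalgebra K (trace_hyperplane L q n \<alpha>) L"
proof -
  let ?V = "trace_hyperplane L q n \<alpha>"
  have KL: "K \<subseteq> carrier L" using subfieldE(3)[OF K] .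
  have zK: "\<zero> \<in> K" and mK: "\<ominus> \<one> \<in> K"
    using subringE(2,3,5)[OF subfieldE(1)[OF K]] by auto
  have smult: "c \<otimes> v \<in> ?V" if "c \<in> K" "v \<in> ?V" for c v
    using that a KL trace_linear(2)[of "\<alpha> \<otimes> v" "\<alpha> \<otimes> v" c]
    by (auto simp: trace_hyperplane_def subset_iff m_lcomm)
  have add: "u \<oplus> v \<in> ?V" if "u \<in> ?V" "v \<in> ?V" for u v
    using that a trace_linear(1)[of "\<alpha> \<otimes> u" "\<alpha> \<otimes> v" \<zero>] zK
    by (auto simp: trace_hyperplane_def r_distr)
  have zero: "\<zero> \<in> ?V"
    using a trace_linear(2)[of \<zero> \<zero> \<zero>] zK frobenius_iter_linear(1)[of \<zero> \<zero> \<zero>]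
    by (auto simp: trace_hyperplane_def field_trace_def)
  have sub: "?V \<subseteq> carrier L" by (auto simp: trace_hyperplane_def)
  have minus: "\<ominus> v \<in> ?V" if "v \<in> ?V" for v
    using smult[OF mK that] that sub by (auto simp: l_minus)
  have "subgroup ?V (add_monoid L)"
    by (rule add.subgroupI) (use sub zero minus add in auto)
  then show ?thesis
    by (intro subalgebra.intro subalgebra_axioms.intro) (auto intro: smult)
qed

end

end

theory Submission
  imports Defs
begin

text \<open>
  Since the trace is Frobenius-invariant, \<open>x\<close> lies in \<open>\<sigma>\<^sup>i V\<^sub>\<alpha>\<close> iff \<open>Tr (\<sigma>\<^sup>i \<alpha> \<cdot> x) = 0\<close>; so \<open>V\<^sub>\<alpha>\<close> is
  cyclically covering iff every \<open>x\<close> is killed by one of the functionals \<open>x \<mapsto> Tr (\<sigma>\<^sup>i \<alpha> \<cdot> x)\<close>.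
  The trace form is nondegenerate, hence for independent \<open>v\<^sub>1, \<dots>, v\<^sub>t\<close> the tuple
  \<open>(Tr (v\<^sub>1 x), \<dots>, Tr (v\<^sub>t x))\<close> takes all values in \<open>F\<^sub>q\<^sup>t\<close>. For (i) choose \<open>x\<close> with all these traces
  equal to 1; for (ii) expand \<open>Tr (\<sigma>\<^sup>i \<alpha> \<cdot> x)\<close> in the coordinates \<open>Tr (\<sigma>\<^bsup>j-1\<^esup> \<alpha> \<cdot> x)\<close>.
\<close>

locale finite_field_extension = field L for L (structure) +
  fixes K :: "'a set" and q n :: nat
  assumes subfield_K: "subfield K L" and primepow_q: "primepow q" and n_pos: "n > 0"
    and card_K: "card K = q" and card_L: "card (carrier L) = q ^ n"
begin

abbreviation frob where "frob \<equiv> frobenius L q"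
abbreviation tr where "tr \<equiv> field_trace L q n"

lemmas K_carrier = subfieldE(3)[OF subfield_K, THEN subsetD]
lemmas K_subring = subringE(2-3,5-7)[OF subfieldE(1)[OF subfield_K]]
text \<open>In the order in which the facts on \<open>frobenius\<close> and
  \<open>field_trace\<close> take their assumptions, so that one \<open>OF\<close> discharges them
  all.\<close>

lemmas context_assms = field_axioms subfield_K primepow_q card_K card_L

lemma q_gt_1: "q > 1"
  using primepow_gt_Suc_0[OF primepow_q] by simp

lemma finite_L: "finite (carrier L)"
  using card_L q_gt_1 by (intro card_ge_0_finite) simp

section \<open>Iterates of the Frobenius map and its fixed field\<close>

lemma frobenius_funpow: "x \<in> carrier L \<Longrightarrow> (frob ^^ i) x = x [^] (q ^ i)"
  by (induction i) (auto simp: frobenius_def nat_pow_pow mult.commute)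

lemma frobenius_funpow_closed: "x \<in> carrier L \<Longrightarrow> (frob ^^ i) x \<in> carrier L"
  by (simp add: frobenius_funpow)

lemma frobenius_funpow_mult:
  "x \<in> carrier L \<Longrightarrow> y \<in> carrier L \<Longrightarrow> (frob ^^ i) (x \<otimes> y) = (frob ^^ i) x \<otimes> (frob ^^ i) y"
  by (simp add: frobenius_funpow nat_pow_distrib)

text \<open>Lagrange's theorem in the multiplicative group, of order \<open>q ^ n - 1\<close>,
  settles nonzero \<open>x\<close>; zero is checked separately.\<close>

lemma frobenius_funpow_n:
  assumes x: "x \<in> carrier L"
  shows "(frob ^^ n) x = x"
proof (cases "x = \<zero>")
  case True
  then show ?thesis using q_gt_1 by (simp add: frobenius_funpow nat_pow_zero)
next
  case False
  have "order (Multiplicative_Group.mult_of L) = q ^ n - 1"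
    using order_mult_of[OF finite_L] card_L by (simp add: order_def)
  then have "x [^] (q ^ n - 1) = \<one>"
    using group.pow_order_eq_1[OF field_mult_group, of x] x False
    by (simp add: Multiplicative_Group.nat_pow_mult_of)
  then have "x [^] Suc (q ^ n - 1) = x" using x by simp
  then show ?thesis using q_gt_1 x by (simp add: frobenius_funpow)
qed

text \<open>A counting argument: every element of \<open>K\<close> is fixed, and there are at most
  \<open>q = card K\<close> fixed points, namely zero and at most \<open>q - 1\<close> roots of
  \<open>X^(q-1) = 1\<close>.\<close>

lemma frobenius_fixed_iff:
  assumes x: "x \<in> carrier L"
  shows "frob x = x \<longleftrightarrow> x \<in> K"
proof -
  let ?F = "{y \<in> carrier L. frob y = y}"
  let ?R = "{y \<in> carrier L. y [^] (q - 1) = \<one>}"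
  have "?F \<subseteq> insert \<zero> ?R"
  proof
    fix y assume y: "y \<in> ?F"
    then have "y \<otimes> y [^] (q - 1) = y \<otimes> \<one>"
      using q_gt_1 nat_pow_Suc2[of y "q - 1"] by (simp add: frobenius_def)
    then show "y \<in> insert \<zero> ?R"
      using y m_lcancel[of y "y [^] (q - 1)" \<one>] by auto
  qed
  then have "card ?F \<le> card (insert \<zero> ?R)"
    using finite_L by (intro card_mono) auto
  also have "\<dots> \<le> Suc (card ?R)" using finite_L by (intro card_insert_le_m1) auto
  also have "\<dots> \<le> q" using num_roots_le_deg[OF finite_L, of "q - 1"] q_gt_1 by simp
  finally have "card ?F \<le> card K" using card_K by simp
  moreover have "K \<subseteq> ?F"
    using K_carrier frobenius_fixes_subfield[OF context_assms] by auto
  ultimately have "K = ?F" using finite_L by (intro card_seteq) auto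
  then show ?thesis using x by auto
qed

section \<open>The trace: linearity, Frobenius invariance, values in K, nonvanishing\<close>

lemma trace_closed: "x \<in> carrier L \<Longrightarrow> tr x \<in> carrier L"
  by (auto simp: field_trace_def frobenius_funpow_closed)

lemma trace_add:
  "x \<in> carrier L \<Longrightarrow> y \<in> carrier L \<Longrightarrow> tr (x \<oplus> y) = tr x \<oplus> tr y"
  using trace_linear(1)[OF context_assms _ _ K_subring(1)] by simp

lemma trace_smult:
  "c \<in> K \<Longrightarrow> x \<in> carrier L \<Longrightarrow> tr (c \<otimes> x) = c \<otimes> tr x"
  using trace_linear(2)[OF context_assms] by blast

text \<open>Frobenius permutes the summands cyclically, since its \<open>n\<close>-th iterate is the
  identity.\<close>

lemma trace_frobenius:
  assumes x: "x \<in> carrier L"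
  shows "tr (frob x) = tr x"
proof -
  obtain m where m: "n = Suc m" using n_pos gr0_implies_Suc by auto
  note cl = frobenius_funpow_closed[OF x]
  have sx: "frob x \<in> carrier L" using cl[of 1] by simp
  have "tr (frob x) = (\<Oplus>i\<in>{..m}. (frob ^^ Suc i) x)"
    unfolding field_trace_def m lessThan_Suc_atMost by (simp add: funpow_swap1)
  \<comment> \<open>The sum of the iterates 1 to \<open>n\<close> is completed by the term for 0,
    which is \<open>x\<close>. Splitting off the top term instead then leaves the trace, and the top
    term cancels against \<open>x\<close>.\<close>
  also have "\<dots> = (\<Oplus>i\<in>{..Suc m}. (frob ^^ i) x) \<ominus> x"
    using cl x cl[of "Suc m"]
    by (subst finsum_Suc2) (auto simp: minus_eq a_assoc r_neg simp del: funpow.simps)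
  also have "\<dots> = ((frob ^^ n) x \<oplus> tr x) \<ominus> x"
    using cl by (subst finsum_Suc) (auto simp: field_trace_def m lessThan_Suc_atMost simp del: funpow.simps)
  also have "\<dots> = tr x"
    using x trace_closed[OF x] unfolding frobenius_funpow_n[OF x]
    by (simp add: minus_eq a_comm[of x] a_assoc r_neg)
  finally show ?thesis .
qed

lemma trace_frobenius_funpow:
  assumes x: "x \<in> carrier L"
  shows "tr ((frob ^^ i) x) = tr x"
  by (induction i) (use trace_frobenius frobenius_funpow_closed[OF x] in auto)

text \<open>Frobenius is additive and commutes with its own iterates, so it sends
  \<open>tr x\<close> to \<open>tr (frob x) = tr x\<close>; the fixed points are exactly
  \<open>K\<close>.\<close>

lemma trace_in_K:
  assumes x: "x \<in> carrier L"
  shows "tr x \<in> K"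
proof -
  have cl: "(frob ^^ i) x \<in> carrier L" for i using frobenius_funpow_closed[OF x] .
  have z: "frob \<zero> = \<zero>" using q_gt_1 by (simp add: frobenius_def nat_pow_zero)
  have "frob (\<Oplus>i\<in>{..<m}. (frob ^^ i) x) = (\<Oplus>i\<in>{..<m}. (frob ^^ i) (frob x))" for m
  proof (induction m)
    case (Suc m)
    have "frob x \<in> carrier L" using cl[of 1] by simp
    then show ?case
      using Suc cl frobenius_add[OF context_assms cl[of m]]
        frobenius_funpow_closed[of "frob x"]
      by (simp add: lessThan_Suc funpow_swap1 Pi_def)
  qed (simp add: z)
  then have "frob (tr x) = tr (frob x)" by (simp add: field_trace_def)
  then show ?thesis
    using frobenius_fixed_iff[OF trace_closed[OF x]] trace_frobenius[OF x] by simp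
qed

text \<open>Otherwise all \<open>q\<^sup>n\<close> elements would be roots of \<open>X + X\<^sup>q + \<dots> + X\<^bsup>q^(n-1)\<^esup>\<close>.\<close>

lemma trace_nonzero: "\<exists>x \<in> carrier L. tr x \<noteq> \<zero>"
proof (rule ccontr)
  assume "\<not> ?thesis"
  then have tr0: "tr x = \<zero>" if "x \<in> carrier L" for x using that by blast
  \<comment> \<open>The polynomial is \<open>X + X^q + ... + X^(q^m)\<close>, as a coefficient list.
    Each step adds a monomial of strictly larger degree, so no leading term cancels; the length is
    the degree plus one and fixes the degree for the root bound.\<close>
  have "\<exists>p. polynomial (carrier L) p \<and> length p = Suc (q ^ m) \<and>
      (\<forall>x\<in>carrier L. eval p x = (\<Oplus>i\<in>{..<Suc m}. (frob ^^ i) x))" for m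
  proof (induction m)
    case 0
    have "polynomial (carrier L) (monom \<one> 1)"
      by (rule monom_is_polynomial[OF carrier_is_subring]) auto
    then show ?case
      by (intro exI[of _ "monom \<one> 1"]) (auto simp: eval_monom lessThan_Suc, simp add: monom_def)
  next
    case (Suc m)
    then obtain p where p: "polynomial (carrier L) p" "length p = Suc (q ^ m)"
      "\<And>x. x \<in> carrier L \<Longrightarrow> eval p x = (\<Oplus>i\<in>{..<Suc m}. (frob ^^ i) x)" by blast
    let ?M = "monom \<one> (q ^ Suc m)"
    have M: "polynomial (carrier L) ?M"
      by (rule monom_is_polynomial[OF carrier_is_subring]) auto
    have lM: "length ?M = Suc (q ^ Suc m)" by (simp add: monom_def)
    have lt: "q ^ m < q ^ Suc m" using q_gt_1 by simp
    have "eval (poly_add ?M p) x = (\<Oplus>i\<in>{..<Suc (Suc m)}. (frob ^^ i) x)" if x: "x \<in> carrier L" for x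
    proof -
      have "eval (poly_add ?M p) x = eval ?M x \<oplus> eval p x"
        using eval_poly_add polynomial_incl[OF M] polynomial_incl[OF p(1)] x by blast
      also have "eval ?M x = (frob ^^ Suc m) x"
        using x by (simp only: eval_monom one_closed frobenius_funpow l_one nat_pow_closed)
      finally show ?thesis
        using p(3)[OF x] frobenius_funpow_closed[OF x] frobenius_funpow_closed[OF x, of "Suc m"]
        by (subst lessThan_Suc) (simp add: Pi_def del: funpow.simps)
    qed
    moreover have "length (poly_add ?M p) = Suc (q ^ Suc m)"
      using poly_add_length_eq[OF carrier_is_subring M p(1)] lM p(2) lt by simp
    ultimately show ?case
      using poly_add_closed[OF carrier_is_subring M p(1)] by blast
  qed
  from this[of "n - 1"] obtain p where p: "polynomial (carrier L) p" "length p = Suc (q ^ (n - 1))"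
    "\<And>x. x \<in> carrier L \<Longrightarrow> eval p x = tr x"
    using n_pos by (auto simp: field_trace_def)
  have pc: "p \<in> carrier (poly_ring L)" using p(1) by (simp add: univ_poly_carrier)
  have "carrier L \<subseteq> set_mset (roots p)"
    using p tr0 roots_mem_iff_is_root[OF pc] by (auto simp: is_root_def)
  then have "q ^ n \<le> card (set_mset (roots p))"
    unfolding card_L[symmetric] by (intro card_mono) auto
  \<comment> \<open>Every root is counted with multiplicity at least one.\<close>
  also have "\<dots> \<le> size (roots p)"
    unfolding size_multiset_overloaded_eq card_eq_sum by (intro sum_mono) (simp add: Suc_le_eq)
  also have "\<dots> \<le> q ^ (n - 1)" using size_roots_le_degree[OF pc] p(2) by simp
  also have "\<dots> < q ^ n" using n_pos q_gt_1 by simp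
  finally show False by simp
qed

section \<open>Duality under the trace form\<close>

text \<open>Multiplication by a nonzero \<open>u\<close> is onto, so the hypothesis would make the
  trace vanish everywhere.\<close>

lemma trace_form_nondegenerate:
  assumes u: "u \<in> carrier L" and tr0: "\<And>x. x \<in> carrier L \<Longrightarrow> tr (u \<otimes> x) = \<zero>"
  shows "u = \<zero>"
proof (rule ccontr)
  assume "u \<noteq> \<zero>"
  then have iu: "inv u \<in> carrier L" "u \<otimes> inv u = \<one>" using u field_Units by auto
  obtain x where x: "x \<in> carrier L" "tr x \<noteq> \<zero>" using trace_nonzero by blast
  have "u \<otimes> (inv u \<otimes> x) = x" using iu x u by (simp add: m_assoc[symmetric])
  then show False using tr0[of "inv u \<otimes> x"] iu x by simp
qed

text \<open>The trace-form version of the fact that a functional vanishing on the common kernel of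
  finitely many functionals is a combination of them. Nondegeneracy settles the empty list and so
  carries the result from functionals back to elements of \<open>L\<close>.\<close>

lemma in_Span_if_annihilates:
  assumes "set vs \<subseteq> carrier L" "u \<in> carrier L"
    and "\<And>x. x \<in> carrier L \<Longrightarrow> (\<forall>v\<in>set vs. tr (v \<otimes> x) = \<zero>) \<Longrightarrow> tr (u \<otimes> x) = \<zero>"
  shows "u \<in> Span K vs"
  using assms
proof (induction vs arbitrary: u)
  case Nil
  then show ?case using trace_form_nondegenerate by simp
next
  case (Cons v vs)
  then have v: "v \<in> carrier L" and vs: "set vs \<subseteq> carrier L" and u: "u \<in> carrier L" by auto
  let ?N = "\<lambda>x. x \<in> carrier L \<and> (\<forall>w\<in>set vs. tr (w \<otimes> x) = \<zero>)"
  have memI: "c \<otimes> v \<oplus> w \<in> Span K (v # vs)" if "c \<in> K" "w \<in> Span K vs" for c w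
    using that line_extension_mem_iff by auto
  show ?case
  \<comment> \<open>If the conditions from \<open>vs\<close> already force the one from
    \<open>v\<close>, then \<open>u\<close> satisfies the induction hypothesis for \<open>vs\<close>
    and \<open>v\<close> enters with coefficient zero. Otherwise some \<open>e\<close> is killed by
    \<open>vs\<close> but not by \<open>v\<close>.\<close>
  proof (cases "\<forall>x. ?N x \<longrightarrow> tr (v \<otimes> x) = \<zero>")
    case True
    then have "u \<in> Span K vs" using Cons.prems by (intro Cons.IH) auto
    then show ?thesis using memI[OF K_subring(1)] u v by fastforce
  next
    case False
    then obtain e where e: "?N e" "tr (v \<otimes> e) \<noteq> \<zero>" by blast
    \<comment> \<open>The coefficient for which \<open>w = u - a v\<close> is orthogonal to
      \<open>e\<close>.\<close>
    define a where "a = tr (u \<otimes> e) \<otimes> inv (tr (v \<otimes> e))"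
    have te: "tr (u \<otimes> e) \<in> K" "tr (v \<otimes> e) \<in> K - {\<zero>}"
      using e u v trace_in_K by auto
    have aK: "a \<in> K" unfolding a_def
      using te subfield_m_inv(1)[OF subfield_K te(2)] K_subring by auto
    define w where "w = u \<ominus> a \<otimes> v"
    have aL: "a \<in> carrier L" using aK K_carrier by blast
    have w: "w \<in> carrier L" using u v aL by (simp add: w_def)
    have u_eq: "u = a \<otimes> v \<oplus> w"
      using u v aL by (simp add: w_def minus_eq a_lcomm r_neg)
    have tru: "tr (u \<otimes> x) = a \<otimes> tr (v \<otimes> x) \<oplus> tr (w \<otimes> x)" if x: "x \<in> carrier L" for x
    proof -
      have "u \<otimes> x = a \<otimes> (v \<otimes> x) \<oplus> w \<otimes> x"
        using x v w aL by (subst u_eq) (simp add: l_distr m_assoc)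
      then show ?thesis using trace_add[of "a \<otimes> (v \<otimes> x)" "w \<otimes> x"] trace_smult[OF aK] x v w aL by simp
    qed
    have "tr (w \<otimes> e) = \<zero>"
    proof -
      have "a \<otimes> tr (v \<otimes> e) = tr (u \<otimes> e)"
        unfolding a_def using te K_carrier subfield_m_inv[OF subfield_K te(2)]
        by (simp add: m_assoc)
      then have "tr (u \<otimes> e) = tr (u \<otimes> e) \<oplus> tr (w \<otimes> e)" using tru[of e] e by simp
      then show ?thesis using trace_closed e u w add.l_cancel_one' by auto
    qed
    have "w \<in> Span K vs"
    proof (rule Cons.IH[OF vs w])
      fix x assume x: "x \<in> carrier L" "\<forall>y\<in>set vs. tr (y \<otimes> x) = \<zero>"
      \<comment> \<open>Chosen so that \<open>x + c e\<close> is killed by \<open>v\<close> as well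
        as by \<open>vs\<close>, hence by \<open>u\<close> and by \<open>w\<close>. As
        \<open>w\<close> is orthogonal to \<open>e\<close>, it then kills \<open>x\<close>
        itself.\<close>
      define c where "c = \<ominus> (tr (v \<otimes> x) \<otimes> inv (tr (v \<otimes> e)))"
      have cK: "c \<in> K" unfolding c_def
        using trace_in_K v x te subfield_m_inv(1)[OF subfield_K te(2)] K_subring by auto
      have cL: "c \<in> carrier L" using cK K_carrier by blast
      have trx: "tr (y \<otimes> (x \<oplus> c \<otimes> e)) = tr (y \<otimes> x) \<oplus> c \<otimes> tr (y \<otimes> e)"
        if y: "y \<in> carrier L" for y
      proof -
        have "y \<otimes> (x \<oplus> c \<otimes> e) = y \<otimes> x \<oplus> c \<otimes> (y \<otimes> e)"
          using x y cL e by (simp add: r_distr m_lcomm)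
        then show ?thesis
          using trace_add[of "y \<otimes> x" "c \<otimes> (y \<otimes> e)"] trace_smult[OF cK] x y cL e by simp
      qed
      have "c \<otimes> tr (v \<otimes> e) = \<ominus> tr (v \<otimes> x)"
        unfolding c_def using te K_carrier subfield_m_inv[OF subfield_K te(2)] trace_closed v x
        by (simp add: l_minus m_assoc)
      then have "tr (v \<otimes> (x \<oplus> c \<otimes> e)) = \<zero>"
        using trx[OF v] trace_closed v x by (simp add: r_neg)
      moreover have "tr (y \<otimes> (x \<oplus> c \<otimes> e)) = \<zero>" if "y \<in> set vs" for y
        using trx[of y] that vs x e cL by auto
      ultimately have "tr (u \<otimes> (x \<oplus> c \<otimes> e)) = \<zero>"
        and v0: "tr (v \<otimes> (x \<oplus> c \<otimes> e)) = \<zero>"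
        using Cons.prems(3)[of "x \<oplus> c \<otimes> e"] x e cL by auto
      then have "tr (w \<otimes> (x \<oplus> c \<otimes> e)) = \<zero>"
        using tru[of "x \<oplus> c \<otimes> e"] x e cL aL trace_closed w by simp
      then show "tr (w \<otimes> x) = \<zero>"
        using trx[OF w] \<open>tr (w \<otimes> e) = \<zero>\<close> cL trace_closed w x by simp
    qed
    then show ?thesis using memI[OF aK] u_eq by simp
  qed
qed

text \<open>Induction on the list: a solution \<open>y\<close> for the tail is corrected by a
  multiple of an element \<open>e\<close> that the tail does not see.\<close>

lemma trace_interpolation:
  assumes "independent K vs" and "\<And>j. j < length vs \<Longrightarrow> c j \<in> K"
  shows "\<exists>x\<in>carrier L. \<forall>j<length vs. tr (vs ! j \<otimes> x) = c j"
  using assms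
proof (induction vs arbitrary: c rule: list.induct)
  case Nil
  then show ?case by auto
next
  case (Cons v vs)
  note ind = independent_backwards[OF Cons.prems(1)]
  note v = ind(3)
  have vs: "set vs \<subseteq> carrier L" using independent_in_carrier[OF ind(2)] .
  obtain y where y: "y \<in> carrier L" "\<And>j. j < length vs \<Longrightarrow> tr (vs ! j \<otimes> y) = c (Suc j)"
    using Cons.IH[OF ind(2), of "\<lambda>j. c (Suc j)"] Cons.prems(2) by auto
  \<comment> \<open>Independence puts \<open>v\<close> outside the span of \<open>vs\<close>, so by
    contraposition of \<open>in_Span_if_annihilates\<close> some element is killed by
    \<open>vs\<close> but not by \<open>v\<close>.\<close>
  obtain e where e: "e \<in> carrier L" "\<And>w. w \<in> set vs \<Longrightarrow> tr (w \<otimes> e) = \<zero>" "tr (v \<otimes> e) \<noteq> \<zero>"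
    using in_Span_if_annihilates[OF vs v] ind(1) by blast
  have te: "tr (v \<otimes> e) \<in> K - {\<zero>}" using e v trace_in_K by auto
  \<comment> \<open>The error of \<open>y\<close> at the head \<open>v\<close>; dividing it by
    \<open>tr (v e)\<close> gives the multiple of \<open>e\<close> to add.\<close>
  define b where "b = c 0 \<ominus> tr (v \<otimes> y)"
  have c0: "c 0 \<in> K" using Cons.prems(2) by simp
  have bK: "b \<in> K" unfolding b_def minus_eq using c0 trace_in_K v y K_subring by auto
  define a where "a = b \<otimes> inv (tr (v \<otimes> e))"
  have aK: "a \<in> K" unfolding a_def using bK subfield_m_inv(1)[OF subfield_K te] K_subring by auto
  have L: "a \<in> carrier L" "b \<in> carrier L" "c 0 \<in> carrier L" using aK bK c0 K_carrier by auto
  have trx: "tr (w \<otimes> (y \<oplus> a \<otimes> e)) = tr (w \<otimes> y) \<oplus> a \<otimes> tr (w \<otimes> e)" if w: "w \<in> carrier L" for w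
  proof -
    have "w \<otimes> (y \<oplus> a \<otimes> e) = w \<otimes> y \<oplus> a \<otimes> (w \<otimes> e)"
      using y w L e by (simp add: r_distr m_lcomm)
    then show ?thesis
      using trace_add[of "w \<otimes> y" "a \<otimes> (w \<otimes> e)"] trace_smult[OF aK] y w L e by simp
  qed
  have "a \<otimes> tr (v \<otimes> e) = b"
    unfolding a_def using te K_carrier subfield_m_inv[OF subfield_K te] L by (simp add: m_assoc)
  then have "tr (v \<otimes> (y \<oplus> a \<otimes> e)) = c 0"
    using trx[OF v] trace_closed v y L by (simp add: b_def minus_eq a_lcomm r_neg)
  moreover have "tr (vs ! j \<otimes> (y \<oplus> a \<otimes> e)) = c (Suc j)" if "j < length vs" for j
    using trx[of "vs ! j"] that vs y(2)[OF that] e(2) L K_carrier Cons.prems(2)[of "Suc j"]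
    by (auto simp: subset_iff)
  ultimately have "\<forall>j<length (v # vs). tr ((v # vs) ! j \<otimes> (y \<oplus> a \<otimes> e)) = c j"
    by (auto simp: less_Suc_eq_0_disj)
  then show ?case using y e L by blast
qed

section \<open>Covering by the conjugate hyperplanes, and its form in coordinates\<close>

lemma trace_finsum:
  assumes "finite A" "\<And>j. j \<in> A \<Longrightarrow> f j \<in> carrier L"
  shows "tr (\<Oplus>j\<in>A. f j) = (\<Oplus>j\<in>A. tr (f j))"
  using assms
proof (induction A rule: finite_induct)
  case empty
  show ?case using trace_smult[OF K_subring(1) zero_closed] trace_closed by simp
next
  case (insert a A)
  then show ?case by (simp add: trace_add trace_closed Pi_def)
qed

lemma cyclically_covering_trace_hyperplane_iff:
  assumes \<alpha>: "\<alpha> \<in> carrier L"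
  shows "cyclically_covering L K q n (trace_hyperplane L q n \<alpha>) \<longleftrightarrow>
    (\<forall>x\<in>carrier L. \<exists>i<n. tr ((frob ^^ i) \<alpha> \<otimes> x) = \<zero>)"
proof -
  let ?V = "trace_hyperplane L q n \<alpha>"
  \<comment> \<open>Moving both factors by the same iterate preserves the trace of the product, so
    the image of the hyperplane of \<open>\<alpha>\<close> is the hyperplane of its
    conjugate.\<close>
  have shift: "tr ((frob ^^ i) \<alpha> \<otimes> (frob ^^ i) x) = tr (\<alpha> \<otimes> x)" if "x \<in> carrier L" for i x
    using trace_frobenius_funpow[of "\<alpha> \<otimes> x" i] frobenius_funpow_mult[OF \<alpha> that] \<alpha> that by simp
  have mem: "y \<in> (frob ^^ i) ` ?V \<longleftrightarrow> tr ((frob ^^ i) \<alpha> \<otimes> y) = \<zero>" if y: "y \<in> carrier L" and i: "i < n" for y i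
  proof
    show "tr ((frob ^^ i) \<alpha> \<otimes> y) = \<zero>" if "y \<in> (frob ^^ i) ` ?V"
      using that shift by (auto simp: trace_hyperplane_def)
    assume t: "tr ((frob ^^ i) \<alpha> \<otimes> y) = \<zero>"
    \<comment> \<open>The iterate \<open>n - i\<close> inverts the iterate \<open>i\<close>, so this
      is the preimage of \<open>y\<close>.\<close>
    define x where "x = (frob ^^ (n - i)) y"
    have x: "x \<in> carrier L" using y frobenius_funpow_closed by (simp add: x_def)
    have "(frob ^^ i) x = (frob ^^ (i + (n - i))) y" unfolding x_def by (simp only: funpow_add o_apply)
    then have "(frob ^^ i) x = y" using i frobenius_funpow_n[OF y] by simp
    moreover from this have "x \<in> ?V" using shift[OF x, of i] t x by (simp add: trace_hyperplane_def)
    ultimately show "y \<in> (frob ^^ i) ` ?V" by blast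
  qed
  have sub: "(frob ^^ i) ` ?V \<subseteq> carrier L" for i
    using frobenius_funpow_closed by (auto simp: trace_hyperplane_def)
  have "(\<Union>i\<in>{..<n}. (frob ^^ i) ` ?V) = carrier L \<longleftrightarrow>
      (\<forall>y\<in>carrier L. \<exists>i<n. y \<in> (frob ^^ i) ` ?V)"
    using sub by blast
  also have "\<dots> \<longleftrightarrow> (\<forall>y\<in>carrier L. \<exists>i<n. tr ((frob ^^ i) \<alpha> \<otimes> y) = \<zero>)"
    using mem by blast
  finally show ?thesis
    using trace_hyperplane_subspace[OF context_assms \<alpha>] by (simp add: cyclically_covering_def)
qed

lemma not_cyclically_covering_if_independent:
  assumes \<alpha>: "\<alpha> \<in> carrier L" and ind: "independent K (conjugates L q n \<alpha>)"
  shows "\<not> cyclically_covering L K q n (trace_hyperplane L q n \<alpha>)"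
proof -
  obtain x where "x \<in> carrier L" "\<forall>i<n. tr ((frob ^^ i) \<alpha> \<otimes> x) = \<one>"
    using trace_interpolation[OF ind, of "\<lambda>_. \<one>"] K_subring by (auto simp: conjugates_def)
  then show ?thesis
    unfolding cyclically_covering_trace_hyperplane_iff[OF \<alpha>] by force
qed

text \<open>For \<open>i < t\<close> the trace against the \<open>i\<close>-th conjugate is itself a
  coordinate. A zero coordinate therefore puts the point in one of the first \<open>t\<close>
  hyperplanes, and a point with all coordinates nonzero can only be covered by some \<open>i\<close>
  with \<open>t \<le> i\<close>.\<close>

lemma cyclically_covering_iff_coordinates:
  assumes \<alpha>: "\<alpha> \<in> carrier L"
    and ind: "independent K (conjugates L q t \<alpha>)"
    and sub: "set (conjugates L q t \<alpha>) \<subseteq> set (conjugates L q n \<alpha>)"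
    and kK: "\<And>i j. i < n \<Longrightarrow> j \<in> {1..t} \<Longrightarrow> k i j \<in> K"
    and k: "\<And>i. i < n \<Longrightarrow> (frob ^^ i) \<alpha> = (\<Oplus>j\<in>{1..t}. k i j \<otimes> (frob ^^ (j - 1)) \<alpha>)"
  shows "cyclically_covering L K q n (trace_hyperplane L q n \<alpha>) \<longleftrightarrow>
    (\<forall>x \<in> {1..t} \<rightarrow> K - {\<zero>}. \<exists>i. t \<le> i \<and> i \<le> n - 1 \<and> (\<Oplus>j\<in>{1..t}. k i j \<otimes> x j) = \<zero>)"
    (is "?C \<longleftrightarrow> ?R")
proof -
  \<comment> \<open>An independent list has no repetitions, so its \<open>t\<close> entries are
    distinct among at most \<open>n\<close> conjugates.\<close>
  have tn: "t \<le> n"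
  proof -
    have "t = card (set (conjugates L q t \<alpha>))"
      using distinct_card[OF independent_distinct[OF subfield_K ind]] by (simp add: conjugates_def)
    also have "\<dots> \<le> card (set (conjugates L q n \<alpha>))" using sub by (intro card_mono) auto
    also have "\<dots> \<le> n" using card_length[of "conjugates L q n \<alpha>"] by (simp add: conjugates_def)
    finally show ?thesis .
  qed
  have expand: "tr ((frob ^^ i) \<alpha> \<otimes> y) = (\<Oplus>j\<in>{1..t}. k i j \<otimes> tr ((frob ^^ (j - 1)) \<alpha> \<otimes> y))"
    if i: "i < n" and y: "y \<in> carrier L" for i y
  proof -
    have kc: "k i j \<in> carrier L" if "j \<in> {1..t}" for j using kK[OF i that] K_carrier by blast
    note cl = frobenius_funpow_closed[OF \<alpha>]
    have "(frob ^^ i) \<alpha> \<otimes> y = (\<Oplus>j\<in>{1..t}. k i j \<otimes> (frob ^^ (j - 1)) \<alpha> \<otimes> y)"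
      using kc cl y by (subst k[OF i], subst finsum_ldistr) auto
    also have "\<dots> = (\<Oplus>j\<in>{1..t}. k i j \<otimes> ((frob ^^ (j - 1)) \<alpha> \<otimes> y))"
      using kc cl y by (intro finsum_cong') (auto simp: m_assoc)
    also have "tr \<dots> = (\<Oplus>j\<in>{1..t}. tr (k i j \<otimes> ((frob ^^ (j - 1)) \<alpha> \<otimes> y)))"
      using kc cl y by (intro trace_finsum) auto
    also have "\<dots> = (\<Oplus>j\<in>{1..t}. k i j \<otimes> tr ((frob ^^ (j - 1)) \<alpha> \<otimes> y))"
      using kc cl y kK[OF i] by (intro finsum_cong') (auto simp: trace_smult trace_closed)
    finally show ?thesis .
  qed
  show ?thesis
    unfolding cyclically_covering_trace_hyperplane_iff[OF \<alpha>]
  proof (intro iffI ballI)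
    fix x assume C: "\<forall>y\<in>carrier L. \<exists>i<n. tr ((frob ^^ i) \<alpha> \<otimes> y) = \<zero>" and x: "x \<in> {1..t} \<rightarrow> K - {\<zero>}"
    \<comment> \<open>List positions start at 0 and coordinates at 1, hence the shift.\<close>
    have "x (Suc j) \<in> K" if "j < t" for j using x that by auto
    then obtain y where y: "y \<in> carrier L" "\<And>j. j < t \<Longrightarrow> tr ((frob ^^ j) \<alpha> \<otimes> y) = x (Suc j)"
      using trace_interpolation[OF ind, of "\<lambda>j. x (Suc j)"] by (auto simp: conjugates_def)
    obtain i where i: "i < n" "tr ((frob ^^ i) \<alpha> \<otimes> y) = \<zero>" using C y by blast
    have "t \<le> i"
    proof (rule ccontr)
      assume "\<not> t \<le> i"
      then have "i < t" "x (Suc i) \<in> K - {\<zero>}" using x by auto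
      then show False using y(2)[of i] i(2) by simp
    qed
    moreover have "(\<Oplus>j\<in>{1..t}. k i j \<otimes> x j) = \<zero>"
    proof -
      have "(\<Oplus>j\<in>{1..t}. k i j \<otimes> x j) = (\<Oplus>j\<in>{1..t}. k i j \<otimes> tr ((frob ^^ (j - 1)) \<alpha> \<otimes> y))"
      proof (rule finsum_cong')
        fix j assume j: "j \<in> {1..t}"
        then show "k i j \<otimes> x j = k i j \<otimes> tr ((frob ^^ (j - 1)) \<alpha> \<otimes> y)"
          using y(2)[of "j - 1"] by auto
      qed (use kK[OF i(1)] K_carrier trace_closed frobenius_funpow_closed[OF \<alpha>] y(1) in auto)
      then show ?thesis using expand[OF i(1) y(1)] i(2) by simp
    qed
    ultimately show "\<exists>i. t \<le> i \<and> i \<le> n - 1 \<and> (\<Oplus>j\<in>{1..t}. k i j \<otimes> x j) = \<zero>"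
      using i(1) by (intro exI[of _ i]) auto
  next
    fix y assume R: ?R and y: "y \<in> carrier L"
    let ?x = "\<lambda>j. tr ((frob ^^ (j - 1)) \<alpha> \<otimes> y)"
    show "\<exists>i<n. tr ((frob ^^ i) \<alpha> \<otimes> y) = \<zero>"
    \<comment> \<open>A vanishing coordinate \<open>j\<close> gives the index \<open>j - 1\<close>
      directly; otherwise the coordinates of \<open>y\<close> form an admissible tuple for the
      right-hand side.\<close>
    proof (cases "\<exists>j\<in>{1..t}. ?x j = \<zero>")
      case True
      then obtain j where j: "j \<in> {1..t}" "?x j = \<zero>" by blast
      have "j - 1 < n" using j(1) tn by auto
      then show ?thesis by (intro exI[of _ "j - 1"] conjI) (use j(2) in simp_all)
    next
      case False
      moreover have "?x j \<in> K" for j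
        by (intro trace_in_K m_closed frobenius_funpow_closed \<alpha> y)
      ultimately have "?x \<in> {1..t} \<rightarrow> K - {\<zero>}" by (intro Pi_I) blast
      from bspec[OF R this] obtain i
        where i: "i \<le> n - 1" "(\<Oplus>j\<in>{1..t}. k i j \<otimes> ?x j) = \<zero>" by blast
      have "i < n" using i(1) n_pos by simp
      from this expand[OF this y] i(2) show ?thesis by (intro exI[of _ i]) simp
    qed
  qed
qed

end

theorem theorem3p4:
  fixes L :: "('a, 'b) ring_scheme" and K :: "'a set" and q n :: nat and \<alpha> :: 'a
  assumes "field L" and "subfield K L"
    and "primepow q" and "n > 0"
    and "card K = q" and "card (carrier L) = q ^ n"
    and "\<alpha> \<in> carrier L" and "\<alpha> \<noteq> \<zero>\<^bsub>L\<^esub>"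
  shows "(ring.independent L K (conjugates L q n \<alpha>) \<longrightarrow>
            \<not> cyclically_covering L K q n (trace_hyperplane L q n \<alpha>))
       \<and> (\<forall>(t::nat) (k :: nat \<Rightarrow> nat \<Rightarrow> 'a).
            maximal_independent_in L K (conjugates L q t \<alpha>) (set (conjugates L q n \<alpha>)) \<longrightarrow>
            (\<forall>i<n. \<forall>j\<in>{1..t}. k i j \<in> K) \<longrightarrow>
            (\<forall>i<n. (frobenius L q ^^ i) \<alpha> =
                     (\<Oplus>\<^bsub>L\<^esub>j\<in>{1..t}. k i j \<otimes>\<^bsub>L\<^esub> (frobenius L q ^^ (j - 1)) \<alpha>)) \<longrightarrow>
            (cyclically_covering L K q n (trace_hyperplane L q n \<alpha>) \<longleftrightarrow>
               (\<forall>x \<in> {1..t} \<rightarrow> K - {\<zero>\<^bsub>L\<^esub>}. \<exists>i. t \<le> i \<and> i \<le> n - 1 \<and>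
                  (\<Oplus>\<^bsub>L\<^esub>j\<in>{1..t}. k i j \<otimes>\<^bsub>L\<^esub> x j) = \<zero>\<^bsub>L\<^esub>)))"
proof -
  interpret finite_field_extension L K q n
    using assms by (simp add: finite_field_extension_def finite_field_extension_axioms_def)
  show ?thesis
  proof (intro conjI impI allI)
    show "\<not> cyclically_covering L K q n (trace_hyperplane L q n \<alpha>)"
      if "independent K (conjugates L q n \<alpha>)"
      using not_cyclically_covering_if_independent[OF assms(7) that] .
  qed (rule cyclically_covering_iff_coordinates[OF assms(7)];
      simp add: maximal_independent_in_def)
qed

end
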